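(* Let $V=(\mathbf v_1,\dots,\mathbf v_{n+r})$ be an $n\times(n+r)$ integer matrix of rank $n$, and let $Q=\mathcal G(V)=(\mathbf w_1,\dots,\mathbf w_{n+r})$ be a Gale dual matrix of $V$. For $I=\{i_1,\dots,i_k\}\subseteq\{1,\dots,n+r\}$ (with $|I|=k$) let $V_I$ be the submatrix of $V$ given by the columns indexed by $I$ and let $Q^I$ be the submatrix of $Q$ given by the columns indexed by $\{1,\dots,n+r\}\setminus I$. Then there is a natural isomorphism $$\mathbb Z^{n+r-k}/\mathcal L_r(Q^I)\;\cong\;\mathcal L_c(V)/\mathcal L_c(V_I).$$
   Context: $n,r$ are positive integers. A Gale dual matrix $\mathcal G(V)$ of an $n\times(n+r)$ integer matrix $V$ of rank $n$ is an $r\times(n+r)$ integer matrix $Q$ whose rows form a $\mathbb Z$-basis of $\ker(V)\subseteq\mathbb Z^{n+r}$, i.e. $\mathcal L_r(Q)=\ker(V)$, where $V$ is viewed as a linear map $\mathbb Z^{n+r}\to\mathbb Z^n$; it is well defined up to left multiplication by $\mathrm{GL}_r(\mathbb Z)$. $\mathcal L_r(A)$ and $\mathcal L_c(A)$ denote the lattices spanned over $\mathbb Z$ by the rows, respectively the columns, of $A$. *)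

theory Defs
  imports
    "HOL-Algebra.Coset"
    "Jordan_Normal_Form.Matrix_Kernel"
    "Jordan_Normal_Form.DL_Rank"
    "Jordan_Normal_Form.DL_Submatrix"
begin

definition row_lattice :: "int mat \<Rightarrow> int vec set" where
  "row_lattice A = vec_module.lattice_of (dim_col A) (rows A)"

definition col_lattice :: "int mat \<Rightarrow> int vec set" where
  "col_lattice A = vec_module.lattice_of (dim_row A) (cols A)"

text \<open>
  The rows of \<open>Q\<close> form a basis of the integer kernel of \<open>V\<close>. Distinctness is required
  because \<open>lin_dep\<close> only sees the set of rows.
\<close>
definition gale_dual :: "nat \<Rightarrow> nat \<Rightarrow> int mat \<Rightarrow> int mat \<Rightarrow> bool" where
  "gale_dual n r V Q \<longleftrightarrow>
     Q \<in> carrier_mat r (n + r) \<and>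
     distinct (rows Q) \<and>
     \<not> module.lin_dep class_ring (module_vec TYPE(int) (n + r)) (set (rows Q)) \<and>
     row_lattice Q = mat_kernel V"

text \<open>Column indices start at 0; the selected columns keep their order.\<close>
definition keep_cols :: "int mat \<Rightarrow> nat set \<Rightarrow> int mat" where
  "keep_cols A I = submatrix A UNIV I"

definition drop_cols :: "int mat \<Rightarrow> nat set \<Rightarrow> int mat" where
  "drop_cols A I = submatrix A UNIV ({..<dim_col A} - I)"

text \<open>
  An additive group of integer vectors of length \<open>m\<close>, for a subgroup \<open>L\<close> of \<open>\<int>\<^sup>m\<close>;
  \<open>monoid_vec\<close> carries vector addition as its group operation.
\<close>
definition lattice_group :: "nat \<Rightarrow> int vec set \<Rightarrow> int vec monoid" where
  "lattice_group m L = (monoid_vec TYPE(int) m)\<lparr>carrier := L\<rparr>"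

end

theory Submission
  imports Defs
begin

text \<open>
  Let \<open>J\<close> be the complement of \<open>I\<close> in the set of column indices. The isomorphism comes from
  the map that sends \<open>x \<in> \<int>\<^sup>J\<close> to the class of \<open>V\<^sub>J x\<close> in the quotient of the column lattice of
  \<open>V\<close> by that of \<open>V\<^sub>I\<close>. Everything follows from one identity: if \<open>z\<close> has the \<open>I\<close>-part \<open>y\<close> and the
  \<open>J\<close>-part \<open>x\<close>, then \<open>V z = V\<^sub>I y + V\<^sub>J x\<close> (\<open>mult_mat_vec_split\<close>), and every pair \<open>(y, x)\<close>
  arises from some \<open>z\<close> (\<open>select_vec_glue\<close>).

  Surjectivity: modulo the column lattice of \<open>V\<^sub>I\<close>, the vector \<open>V z\<close> equals \<open>V\<^sub>J x\<close>.
  Kernel: \<open>V\<^sub>J x\<close> lies in the column lattice of \<open>V\<^sub>I\<close> iff \<open>V\<^sub>J x = V\<^sub>I y\<close> for some \<open>y\<close>, that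
  is, iff \<open>(-y, x)\<close> lies in the integer kernel of \<open>V\<close>. Hence the kernel of the map is the
  projection of \<open>ker V\<close> to the coordinates in \<open>J\<close>
  (\<open>mult_drop_cols_in_col_lattice_keep_cols_iff\<close>). By Gale duality \<open>ker V\<close> is the row lattice of
  \<open>Q\<close>, and projecting a row lattice amounts to deleting columns (\<open>row_lattice_keep_cols\<close>), so the
  kernel is the row lattice of the matrix \<open>Q\<close> with the columns in \<open>I\<close> removed. The first
  isomorphism theorem finishes the proof.
\<close>

section \<open>Lattices as images of matrices\<close>

lemma col_lattice_eq: "col_lattice A = {A *\<^sub>v x | x. x \<in> carrier_vec (dim_col A)}"
proof -
  have A: "A \<in> carrier_mat (dim_row A) (dim_col A)" by simp
  have "A *\<^sub>v x \<in> carrier_vec (dim_row A)" for x by (simp add: carrier_vecI)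
  then show ?thesis
    unfolding col_lattice_def lattice_of_cols_as_mat_mult[OF A] by blast
qed

lemma row_lattice_eq: "row_lattice A = {A\<^sup>T *\<^sub>v c | c. c \<in> carrier_vec (dim_row A)}"
  using col_lattice_eq[of "A\<^sup>T"] by (simp add: row_lattice_def col_lattice_def)

lemma subgroup_col_lattice:
  assumes A: "A \<in> carrier_mat n m"
  shows "subgroup (col_lattice A) (monoid_vec TYPE(int) n)"
proof -
  interpret comm_group "monoid_vec TYPE(int) n" by (rule comm_group_vec)
  have col_lattice_A: "col_lattice A = {A *\<^sub>v x | x. x \<in> carrier_vec m}"
    using A by (simp add: col_lattice_eq)
  show ?thesis
  proof (rule subgroupI)
    show "col_lattice A \<subseteq> carrier (monoid_vec TYPE(int) n)"
      using A by (auto simp: col_lattice_A monoid_vec_simps)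
    show "col_lattice A \<noteq> {}"
      unfolding col_lattice_A using zero_carrier_vec by blast
  next
    fix a assume "a \<in> col_lattice A"
    then obtain x where x: "x \<in> carrier_vec m" and a: "a = A *\<^sub>v x"
      by (auto simp: col_lattice_A)
    have ax: "a \<in> carrier_vec n" using A x a by auto
    have "inv\<^bsub>monoid_vec TYPE(int) n\<^esub> a = - a"
      using ax by (intro inv_equality) (auto simp: monoid_vec_simps)
    also have "- a = A *\<^sub>v (- x)"
      using A x a by (intro eq_vecI) auto
    finally show "inv\<^bsub>monoid_vec TYPE(int) n\<^esub> a \<in> col_lattice A"
      using x by (auto simp: col_lattice_A)
  next
    fix a b assume "a \<in> col_lattice A" "b \<in> col_lattice A"
    then obtain x y where x: "x \<in> carrier_vec m" "a = A *\<^sub>v x"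
      and y: "y \<in> carrier_vec m" "b = A *\<^sub>v y"
      by (auto simp: col_lattice_A)
    then have "a + b = A *\<^sub>v (x + y)"
      using A by (simp add: mult_add_distrib_mat_vec)
    then show "a \<otimes>\<^bsub>monoid_vec TYPE(int) n\<^esub> b \<in> col_lattice A"
      using x y by (auto simp: col_lattice_A monoid_vec_simps intro!: exI[of _ "x + y"])
  qed
qed

section \<open>Splitting coordinates\<close>

text \<open>
  The coordinate projection to the indices in \<open>S\<close>. The entries are enumerated by \<open>pick\<close>, exactly
  as \<open>submatrix\<close> enumerates columns, so that \<open>keep_cols A S\<close> and \<open>select_vec S z\<close> match up.
\<close>
definition select_vec :: "nat set \<Rightarrow> 'a vec \<Rightarrow> 'a vec" where
  "select_vec S v = vec (card {i. i < dim_vec v \<and> i \<in> S}) (\<lambda>i. v $ pick S i)"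

lemma select_vec_carrier:
  assumes "z \<in> carrier_vec m" "S \<subseteq> {..<m}"
  shows "select_vec S z \<in> carrier_vec (card S)"
proof -
  have "{i. i < dim_vec z \<and> i \<in> S} = S" using assms by auto
  then show ?thesis by (simp add: select_vec_def)
qed

lemma keep_cols_carrier:
  assumes "A \<in> carrier_mat n m" "S \<subseteq> {..<m}"
  shows "keep_cols A S \<in> carrier_mat n (card S)"
proof -
  have "{j. j < dim_col A \<and> j \<in> S} = S" using assms by auto
  then show ?thesis using assms(1) by (simp add: keep_cols_def submatrix_def)
qed

lemma bij_betw_pick:
  "bij_betw (pick S) {..<card {i. i < m \<and> i \<in> S}} {i. i < m \<and> i \<in> S}"
proof (rule bij_betw_byWitness[where f' = "\<lambda>i. card {a \<in> S. a < i}"])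
  have lt: "card {a \<in> S. a < i} < card {i. i < m \<and> i \<in> S}" if "i < m" "i \<in> S" for i
    using that by (intro psubset_card_mono) auto
  have fin: "card {i. i < m \<and> i \<in> S} \<le> card S" if "finite S"
    using that by (intro card_mono) auto
  show "\<forall>j\<in>{..<card {i. i < m \<and> i \<in> S}}. card {a \<in> S. a < pick S j} = j"
    using fin by (cases "finite S") (auto simp: card_pick_inf card_pick_le)
  show "\<forall>i\<in>{i. i < m \<and> i \<in> S}. pick S (card {a \<in> S. a < i}) = i"
    by (auto simp: pick_card_in_set)
  show "pick S ` {..<card {i. i < m \<and> i \<in> S}} \<subseteq> {i. i < m \<and> i \<in> S}"
    using fin pick_le[of _ m S]
    by (cases "finite S") (auto simp: pick_in_set_inf intro: pick_in_set_le)
  show "(\<lambda>i. card {a \<in> S. a < i}) ` {i. i < m \<and> i \<in> S} \<subseteq> {..<card {i. i < m \<and> i \<in> S}}"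
    using lt by auto
qed

text \<open>
  Reindexing along \<open>pick\<close> removes the enumeration: multiplying selected columns by selected
  entries gives the part of the sum \<open>A z\<close> that belongs to \<open>S\<close>.
\<close>
lemma mult_keep_cols_select_vec:
  assumes A: "A \<in> carrier_mat n m" and z: "z \<in> carrier_vec m" and i: "i < n"
  shows "(keep_cols A S *\<^sub>v select_vec S z) $ i = (\<Sum>j | j < m \<and> j \<in> S. A $$ (i, j) * z $ j)"
proof -
  let ?c = "card {j. j < m \<and> j \<in> S}"
  have "(keep_cols A S *\<^sub>v select_vec S z) $ i
      = (\<Sum>j = 0..<?c. A $$ (i, pick S j) * z $ pick S j)"
    using A z i
    by (auto simp: keep_cols_def select_vec_def scalar_prod_def dim_submatrix submatrix_index
        pick_UNIV intro!: sum.cong)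
  also have "\<dots> = (\<Sum>j | j < m \<and> j \<in> S. A $$ (i, j) * z $ j)"
    using sum.reindex_bij_betw[OF bij_betw_pick[of S m], of "\<lambda>j. A $$ (i, j) * z $ j"]
    by (simp add: atLeast0LessThan)
  finally show ?thesis .
qed

lemma drop_cols_eq_keep_cols: "drop_cols A I = keep_cols A ({..<dim_col A} - I)"
  by (simp add: drop_cols_def keep_cols_def)

lemma drop_cols_carrier:
  assumes "A \<in> carrier_mat n m"
  shows "drop_cols A I \<in> carrier_mat n (card ({..<m} - I))"
  using keep_cols_carrier[OF assms, of "{..<m} - I"] assms by (simp add: drop_cols_eq_keep_cols)

lemma mult_mat_vec_split:
  assumes A: "A \<in> carrier_mat n m" and z: "z \<in> carrier_vec m"
  shows "A *\<^sub>v z = keep_cols A I *\<^sub>v select_vec I z + drop_cols A I *\<^sub>v select_vec ({..<m} - I) z"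
proof (rule eq_vecI)
  show "dim_vec (A *\<^sub>v z)
      = dim_vec (keep_cols A I *\<^sub>v select_vec I z + drop_cols A I *\<^sub>v select_vec ({..<m} - I) z)"
    using A by (simp add: drop_cols_def dim_submatrix)
next
  fix i
  assume "i < dim_vec (keep_cols A I *\<^sub>v select_vec I z + drop_cols A I *\<^sub>v select_vec ({..<m} - I) z)"
  then have i: "i < n" using A by (simp add: drop_cols_def dim_submatrix)
  let ?f = "\<lambda>j. A $$ (i, j) * z $ j"
  have U: "{0..<m} = {j. j < m \<and> j \<in> I} \<union> {j. j < m \<and> j \<in> {..<m} - I}" by auto
  have "(A *\<^sub>v z) $ i = sum ?f {0..<m}"
    using A z i by (auto simp: scalar_prod_def)
  also have "\<dots> = (\<Sum>j | j < m \<and> j \<in> I. ?f j) + (\<Sum>j | j < m \<and> j \<in> {..<m} - I. ?f j)"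
    unfolding U by (rule sum.union_disjoint) auto
  also have "\<dots> = (keep_cols A I *\<^sub>v select_vec I z) $ i
      + (drop_cols A I *\<^sub>v select_vec ({..<m} - I) z) $ i"
    using A by (simp only: mult_keep_cols_select_vec[OF A z i] drop_cols_eq_keep_cols carrier_matD)
  finally show "(A *\<^sub>v z) $ i
      = (keep_cols A I *\<^sub>v select_vec I z + drop_cols A I *\<^sub>v select_vec ({..<m} - I) z) $ i"
    using A i by (simp add: drop_cols_def dim_submatrix)
qed

text \<open>
  The witness reads the entry at \<open>i\<close> off \<open>y\<close> or \<open>x\<close> at the position of \<open>i\<close> in the enumeration
  of \<open>S\<close> or \<open>T\<close>. That position is the number of smaller elements of the set, so counting
  them inverts \<open>pick\<close>.
\<close>
lemma select_vec_glue:
  assumes "S \<subseteq> {..<m}" "T \<subseteq> {..<m}" "S \<inter> T = {}"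
    and "y \<in> carrier_vec (card S)" "x \<in> carrier_vec (card T)"
  obtains z where "z \<in> carrier_vec m" "select_vec S z = y" "select_vec T z = x"
proof -
  have S: "{i. i < m \<and> i \<in> S} = S" and T: "{i. i < m \<and> i \<in> T} = T"
    using assms by auto
  define z where "z = vec m (\<lambda>i. if i \<in> S then y $ card {a \<in> S. a < i} else x $ card {a \<in> T. a < i})"
  have pS: "pick S j \<in> S" if "j < card S" for j using that by (rule pick_in_set_le)
  have pT: "pick T j \<in> T" if "j < card T" for j using that by (rule pick_in_set_le)
  have "select_vec S z = y"
  proof (rule eq_vecI)
    fix j assume "j < dim_vec y"
    then have j: "j < card S" using assms by auto
    have "pick S j < m" using pS[OF j] assms by auto
    then show "select_vec S z $ j = y $ j"
      using j pS[OF j] by (simp add: select_vec_def z_def S card_pick_le)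
  qed (use assms in \<open>simp add: select_vec_def z_def S\<close>)
  moreover have "select_vec T z = x"
  proof (rule eq_vecI)
    fix j assume "j < dim_vec x"
    then have j: "j < card T" using assms by auto
    have "pick T j < m" "pick T j \<notin> S" using pT[OF j] assms by auto
    then show "select_vec T z $ j = x $ j"
      using j by (simp add: select_vec_def z_def T card_pick_le)
  qed (use assms in \<open>simp add: select_vec_def z_def T\<close>)
  moreover have "z \<in> carrier_vec m" by (simp add: z_def)
  ultimately show thesis using that by blast
qed

text \<open>
  Coordinate projections are linear, so the projection of an integer combination of rows is
  the same combination of the shortened rows.
\<close>
lemma row_lattice_keep_cols: "row_lattice (keep_cols A S) = select_vec S ` row_lattice A"
proof -
  have "(keep_cols A S)\<^sup>T *\<^sub>v c = select_vec S (A\<^sup>T *\<^sub>v c)" if "c \<in> carrier_vec (dim_row A)" for c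
  proof (rule eq_vecI)
    fix j assume "j < dim_vec (select_vec S (A\<^sup>T *\<^sub>v c))"
    then have j: "j < card {j. j < dim_col A \<and> j \<in> S}" by (simp add: select_vec_def)
    then have "pick S j < dim_col A" by (rule pick_le)
    then show "((keep_cols A S)\<^sup>T *\<^sub>v c) $ j = select_vec S (A\<^sup>T *\<^sub>v c) $ j"
      using j that
      by (auto simp: keep_cols_def select_vec_def scalar_prod_def dim_submatrix submatrix_index
          pick_UNIV intro!: sum.cong)
  qed (simp add: keep_cols_def select_vec_def dim_submatrix)
  moreover have "dim_row (keep_cols A S) = dim_row A"
    by (simp add: keep_cols_def dim_submatrix)
  ultimately show ?thesis
    unfolding row_lattice_eq Setcompr_eq_image image_image by (simp cong: image_cong)
qed

section \<open>The isomorphism\<close>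

text \<open>
  A form of the first isomorphism theorem that keeps track of the value on each coset: \<open>h\<close> is
  constant on every coset of its kernel, so the isomorphism takes that constant value.
\<close>
lemma FactGroup_iso_of_hom:
  assumes "group G" "group H" "h \<in> hom G H" "h ` carrier G = carrier H"
  obtains \<phi> where "\<phi> \<in> iso (G Mod Coset.kernel G H h) H"
    and "\<And>x. x \<in> carrier G \<Longrightarrow> \<phi> (Coset.kernel G H h #>\<^bsub>G\<^esub> x) = h x"
proof -
  interpret group_hom G H h
    using assms by (simp add: group_hom_def group_hom_axioms_def)
  have "the_elem (h ` (Coset.kernel G H h #>\<^bsub>G\<^esub> x)) = h x" if x: "x \<in> carrier G" for x
  proof -
    have "h ` (Coset.kernel G H h #>\<^bsub>G\<^esub> x) = {h x}"
      using x by (auto simp: Coset.kernel_def r_coset_def intro!: imageI)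
    then show ?thesis by simp
  qed
  with FactGroup_iso_set[OF assms(4)] show thesis by (rule that)
qed

text \<open>
  The kernel computation: a relation \<open>V\<^sub>J x = V\<^sub>I y\<close> is the same as an element of \<open>ker V\<close> with
  coordinates \<open>-y\<close> on \<open>I\<close> and \<open>x\<close> on the complement \<open>J\<close>.
\<close>
lemma mult_drop_cols_in_col_lattice_keep_cols_iff:
  assumes V: "V \<in> carrier_mat n m" and I: "I \<subseteq> {..<m}"
    and x: "x \<in> carrier_vec (card ({..<m} - I))"
  shows "drop_cols V I *\<^sub>v x \<in> col_lattice (keep_cols V I)
    \<longleftrightarrow> x \<in> select_vec ({..<m} - I) ` mat_kernel V"
proof -
  have K: "keep_cols V I \<in> carrier_mat n (card I)"
    using V I by (rule keep_cols_carrier)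
  have D: "drop_cols V I \<in> carrier_mat n (card ({..<m} - I))"
    using V by (rule drop_cols_carrier)
  have dimK: "dim_row (keep_cols V I) = n" "dim_col (keep_cols V I) = card I"
    using K by auto
  have "x \<in> select_vec ({..<m} - I) ` mat_kernel V"
    if "drop_cols V I *\<^sub>v x \<in> col_lattice (keep_cols V I)"
  proof -
    from that obtain y where y: "y \<in> carrier_vec (card I)" "drop_cols V I *\<^sub>v x = keep_cols V I *\<^sub>v y"
      unfolding col_lattice_eq dimK by auto
    obtain z where z: "z \<in> carrier_vec m" "select_vec I z = - y" "select_vec ({..<m} - I) z = x"
      by (rule select_vec_glue[of I m "{..<m} - I" "- y" x]) (use I y x in auto)
    have "V *\<^sub>v z = keep_cols V I *\<^sub>v (- y) + keep_cols V I *\<^sub>v y"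
      using mult_mat_vec_split[OF V z(1), of I] z y by simp
    also have "\<dots> = keep_cols V I *\<^sub>v (- y + y)"
      using K y by (intro mult_add_distrib_mat_vec[symmetric]) auto
    also have "\<dots> = 0\<^sub>v n"
      using K y by auto
    finally have "z \<in> mat_kernel V" using V z by (auto simp: mat_kernel_def)
    then show ?thesis using z by blast
  qed
  moreover have "drop_cols V I *\<^sub>v x \<in> col_lattice (keep_cols V I)"
    if "x \<in> select_vec ({..<m} - I) ` mat_kernel V"
  proof -
    from that obtain z where z: "z \<in> carrier_vec m" "V *\<^sub>v z = 0\<^sub>v n" "x = select_vec ({..<m} - I) z"
      using V by (auto simp: mat_kernel_def)
    let ?y = "select_vec I z"
    have y: "?y \<in> carrier_vec (card I)"
      using z(1) I by (rule select_vec_carrier)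
    let ?a = "keep_cols V I *\<^sub>v ?y"
    let ?b = "drop_cols V I *\<^sub>v x"
    have ab: "?a \<in> carrier_vec n" "?b \<in> carrier_vec n" "?a + ?b = 0\<^sub>v n"
      using K D y x z mult_mat_vec_split[OF V z(1), of I] by auto
    have neg: "b = - a" if "a \<in> carrier_vec n" "b \<in> carrier_vec n" "a + b = 0\<^sub>v n"
      for a b :: "int vec"
    proof (rule eq_vecI)
      fix i assume "i < dim_vec (- a)"
      then have i: "i < n" using that by auto
      then have "(a + b) $ i = 0" using that(3) by simp
      then show "b $ i = (- a) $ i" using i that(1,2) by simp
    qed (use that in auto)
    have "?b = - ?a" using ab by (rule neg)
    also have "\<dots> = keep_cols V I *\<^sub>v (- ?y)"
      using K y by (intro eq_vecI) auto
    finally show ?thesis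
      using y unfolding col_lattice_eq dimK by auto
  qed
  ultimately show ?thesis by blast
qed

theorem theorem3p2:
  fixes n r k :: nat and V Q :: "int mat" and I :: "nat set"
  assumes "0 < n" and "0 < r"
    and "V \<in> carrier_mat n (n + r)"
    and "vec_space.rank n (map_mat rat_of_int V) = n"
    and "gale_dual n r V Q"
    and "I \<subseteq> {..<n + r}" and "card I = k"
  shows "\<exists>\<phi> \<in> iso (monoid_vec TYPE(int) (n + r - k) Mod row_lattice (drop_cols Q I))
                  (lattice_group n (col_lattice V) Mod col_lattice (keep_cols V I)).
           \<forall>x \<in> carrier_vec (n + r - k).
             \<phi> (row_lattice (drop_cols Q I) #>\<^bsub>monoid_vec TYPE(int) (n + r - k)\<^esub> x)
             = col_lattice (keep_cols V I) #>\<^bsub>lattice_group n (col_lattice V)\<^esub> (drop_cols V I *\<^sub>v x)"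
proof -
  note V = assms(3) and I = assms(6)
  let ?m = "n + r"
  let ?J = "{..<?m} - I"
  let ?K = "keep_cols V I"
  let ?D = "drop_cols V I"
  let ?G = "monoid_vec TYPE(int) (n + r - k)"
  let ?L = "lattice_group n (col_lattice V)"
  let ?N = "col_lattice ?K"
  let ?h = "\<lambda>x. ?N #>\<^bsub>?L\<^esub> (?D *\<^sub>v x)"
  have cardJ: "card ?J = n + r - k"
    using I assms(7) by (simp add: card_Diff_subset finite_subset)
  have K: "?K \<in> carrier_mat n (card I)" and D: "?D \<in> carrier_mat n (n + r - k)"
    using keep_cols_carrier[OF V I] drop_cols_carrier[OF V, of I] by (simp_all add: cardJ)
  have Q: "dim_col Q = ?m" and QV: "row_lattice Q = mat_kernel V"
    using assms(5) by (auto simp: gale_dual_def)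

  interpret G: comm_group ?G by (rule comm_group_vec)
  interpret Z: comm_group "monoid_vec TYPE(int) n" by (rule comm_group_vec)
  have subV: "subgroup (col_lattice V) (monoid_vec TYPE(int) n)"
    using V by (rule subgroup_col_lattice)
  have subN: "subgroup ?N (monoid_vec TYPE(int) n)"
    using K by (rule subgroup_col_lattice)
  interpret L: comm_group ?L
  proof (rule group.group_comm_groupI)
    show "group ?L"
      unfolding lattice_group_def by (rule Z.subgroup_imp_group[OF subV])
    show "a \<otimes>\<^bsub>?L\<^esub> b = b \<otimes>\<^bsub>?L\<^esub> a" if "a \<in> carrier ?L" "b \<in> carrier ?L" for a b
      using that subgroup.subset[OF subV] Z.m_comm[of a b] by (auto simp: lattice_group_def)
  qed
  have carL: "carrier ?L = col_lattice V" and multL: "a \<otimes>\<^bsub>?L\<^esub> b = a + b" for a b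
    by (simp_all add: lattice_group_def monoid_vec_simps)

  have combine: "?K *\<^sub>v y + ?D *\<^sub>v x \<in> col_lattice V"
    if xy: "y \<in> carrier_vec (card I)" "x \<in> carrier_vec (n + r - k)" for x y
  proof -
    obtain z where z: "z \<in> carrier_vec ?m" "select_vec I z = y" "select_vec ?J z = x"
      by (rule select_vec_glue[of I ?m ?J y x]) (use I xy cardJ in auto)
    have "?K *\<^sub>v y + ?D *\<^sub>v x = V *\<^sub>v z"
      using mult_mat_vec_split[OF V z(1), of I] by (simp add: z)
    then show ?thesis using V z(1) by (auto simp: col_lattice_eq)
  qed
  have D_in: "?D *\<^sub>v x \<in> col_lattice V" if x: "x \<in> carrier_vec (n + r - k)" for x
  proof -
    \<comment> \<open>extend \<open>x\<close> by zero on \<open>I\<close>\<close>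
    have "?K *\<^sub>v 0\<^sub>v (card I) + ?D *\<^sub>v x = ?D *\<^sub>v x"
      using K D x by auto
    then show ?thesis using combine[of "0\<^sub>v (card I)" x] x by simp
  qed
  have N_sub: "?N \<subseteq> col_lattice V"
  proof
    fix a assume "a \<in> ?N"
    then obtain y where y: "y \<in> carrier_vec (card I)" "a = ?K *\<^sub>v y"
      using K by (auto simp: col_lattice_eq)
    \<comment> \<open>extend \<open>y\<close> by zero off \<open>I\<close>\<close>
    have "?K *\<^sub>v y + ?D *\<^sub>v 0\<^sub>v (n + r - k) = a"
      using K D y by auto
    then show "a \<in> col_lattice V" using combine[of y "0\<^sub>v (n + r - k)"] y by simp
  qed
  have subNL: "subgroup ?N ?L"
    unfolding lattice_group_def by (rule Z.subgroup_incl[OF subN subV N_sub])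
  interpret N: normal ?N ?L using subNL by (rule L.subgroup_imp_normal)
  interpret H: group "?L Mod ?N" by (rule N.factorgroup_is_group)

  have hom: "?h \<in> hom ?G (?L Mod ?N)"
  proof (rule homI)
    fix x assume "x \<in> carrier ?G"
    then show "?h x \<in> carrier (?L Mod ?N)"
      using D_in by (auto simp: carrier_FactGroup carL monoid_vec_simps)
  next
    fix x y assume "x \<in> carrier ?G" "y \<in> carrier ?G"
    then have xy: "x \<in> carrier_vec (n + r - k)" "y \<in> carrier_vec (n + r - k)"
      by (auto simp: monoid_vec_simps)
    then have "?D *\<^sub>v (x + y) = (?D *\<^sub>v x) \<otimes>\<^bsub>?L\<^esub> (?D *\<^sub>v y)"
      using D by (simp add: multL mult_add_distrib_mat_vec)
    then show "?h (x \<otimes>\<^bsub>?G\<^esub> y) = ?h x \<otimes>\<^bsub>?L Mod ?N\<^esub> ?h y"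
      using N.rcos_sum[of "?D *\<^sub>v x" "?D *\<^sub>v y"] D_in xy by (simp add: carL monoid_vec_simps)
  qed

  have surj: "?h ` carrier ?G = carrier (?L Mod ?N)"
  proof
    show "?h ` carrier ?G \<subseteq> carrier (?L Mod ?N)" using hom by (auto simp: hom_def)
    show "carrier (?L Mod ?N) \<subseteq> ?h ` carrier ?G"
    proof
      fix X assume "X \<in> carrier (?L Mod ?N)"
      then obtain v where v: "v \<in> col_lattice V" "X = ?N #>\<^bsub>?L\<^esub> v"
        unfolding carrier_FactGroup carL by blast
      then obtain z where z: "z \<in> carrier_vec ?m" "v = V *\<^sub>v z"
        using V by (auto simp: col_lattice_eq)
      let ?a = "?K *\<^sub>v select_vec I z" and ?x = "select_vec ?J z"
      have y: "select_vec I z \<in> carrier_vec (card I)"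
        using z(1) I by (rule select_vec_carrier)
      have x: "?x \<in> carrier_vec (n + r - k)"
        using select_vec_carrier[OF z(1), of ?J] by (simp add: cardJ)
      have a: "?a \<in> ?N" using y K by (auto simp: col_lattice_eq)
      \<comment> \<open>the \<open>I\<close>-part of \<open>V z\<close> is absorbed by the coset\<close>
      have "X = ?N #>\<^bsub>?L\<^esub> (?a \<otimes>\<^bsub>?L\<^esub> (?D *\<^sub>v ?x))"
        using v z mult_mat_vec_split[OF V z(1), of I] by (simp add: multL)
      also have "\<dots> = (?N #>\<^bsub>?L\<^esub> ?a) #>\<^bsub>?L\<^esub> (?D *\<^sub>v ?x)"
        using a N_sub D_in[OF x] by (intro L.coset_mult_assoc[symmetric]) (auto simp: carL)
      also have "\<dots> = ?h ?x"
        using L.coset_join2[OF _ subNL a] a N_sub by (auto simp: carL)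
      finally show "X \<in> ?h ` carrier ?G" using x by (auto simp: monoid_vec_simps)
    qed
  qed

  have ker: "Coset.kernel ?G (?L Mod ?N) ?h = row_lattice (drop_cols Q I)"
  proof -
    have coset: "?h x = ?N \<longleftrightarrow> ?D *\<^sub>v x \<in> ?N" if "x \<in> carrier_vec (n + r - k)" for x
      using L.coset_join1[OF _ _ subNL] L.coset_join2[OF _ subNL] D_in[OF that]
      by (auto simp: carL)
    have "select_vec ?J z \<in> carrier_vec (n + r - k)" if "z \<in> mat_kernel V" for z
      using select_vec_carrier[of z ?m ?J] mat_kernelD(1)[OF V that] by (simp add: cardJ)
    then have "Coset.kernel ?G (?L Mod ?N) ?h = select_vec ?J ` mat_kernel V"
      using coset mult_drop_cols_in_col_lattice_keep_cols_iff[OF V I] cardJ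
      by (auto simp: Coset.kernel_def monoid_vec_simps)
    also have "\<dots> = row_lattice (drop_cols Q I)"
      by (simp add: drop_cols_eq_keep_cols row_lattice_keep_cols Q QV)
    finally show ?thesis .
  qed

  show ?thesis
    using FactGroup_iso_of_hom[OF G.is_group H.is_group hom surj, unfolded ker]
    by (metis monoid_vec_simps(2))
qed

end
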